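(* Let $c>0$ be a constant, let $m$ be an integer and let $q\le m^{c}$. Then $T^{\mathrm{ind}}_{\mathrm{prob}}(m,q)=\Omega(\log m)$. In words: any randomized algorithm that finds a spanning forest of graphic matroids on $m$ elements using at most $m^{c}$ independence-oracle queries per round must, for some graphic matroid on $m$ elements, use $\Omega(\log m)$ adaptive rounds in expectation.
   Context: A graphic matroid on $m$ elements has ground set $E=[m]$, the labelled edge set of an unknown graph; $S\subseteq E$ is independent iff it is acyclic; a basis is a spanning forest. A probabilistic parallel decision tree of parallelism $q$ with the independence oracle $\mathrm{Ind}$ has three types of nodes: randomization nodes (branching into $b$ children, each taken with probability $1/b$); oracle query nodes, each containing $q$ sets $B_1,\dots,B_q\subseteq E$, whose children are labelled by the possible answer vectors $(\mathrm{Ind}(B_1),\dots,\mathrm{Ind}(B_q))$, where $\mathrm{Ind}(B)=1$ iff $B$ is acyclic; and leaf nodes, each labelled by a subset of $E$. Such a tree $H$ solves the spanning-forest problem if for every graphic matroid $G$ on $m$ elements and every root-to-leaf path consistent with $G$, the leaf's set is acyclic and has the same rank as $E$ (i.e., is a spanning forest). Let $c(H,G)$ be the expected depth (number of oracle query nodes on the root-to-leaf path) when the input is $G$, $c(H,m)=\max_{G:|G|=m}c(H,G)$, and $T^{\mathrm{ind}}_{\mathrm{prob}}(m,q)=\min_H c(H,m)$ over all such trees $H$ solving the problem. *)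

theory Defs
  imports "HOL-Probability.Probability"
begin

text \<open>
  A graph with edges labelled by natural numbers is given by the map from an edge to its
  (unordered) pair of end vertices.  Loops and parallel edges are allowed, as is usual for
  graphic matroids.  Graphs here are finite, so vertices may be taken to be natural numbers;
  isolated vertices are irrelevant.
\<close>

definition joins :: "(nat \<Rightarrow> nat \<times> nat) \<Rightarrow> nat \<Rightarrow> nat \<Rightarrow> nat \<Rightarrow> bool" where
  "joins ends e x y \<longleftrightarrow> ends e = (x, y) \<or> ends e = (y, x)"

text \<open>A loop is a cycle of length 1, and two parallel edges form a cycle of length 2.\<close>

definition is_cycle :: "(nat \<Rightarrow> nat \<times> nat) \<Rightarrow> nat set \<Rightarrow> bool" where
  "is_cycle ends C \<longleftrightarrow> (\<exists>vs es. es \<noteq> [] \<and> length vs = length es \<and> distinct vs \<and> distinct es \<and>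
     set es = C \<and>
     (\<forall>i<length es. joins ends (es ! i) (vs ! i) (vs ! (Suc i mod length es))))"

definition acyclic_edges :: "(nat \<Rightarrow> nat \<times> nat) \<Rightarrow> nat set \<Rightarrow> bool" where
  "acyclic_edges ends S \<longleftrightarrow> \<not> (\<exists>C\<subseteq>S. is_cycle ends C)"

text \<open>A matroid is represented by its family of independent sets.\<close>

definition graphic_matroid :: "nat \<Rightarrow> nat set set \<Rightarrow> bool" where
  "graphic_matroid m G \<longleftrightarrow> (\<exists>ends. G = {S. S \<subseteq> {1..m} \<and> acyclic_edges ends S})"

definition rank :: "nat set set \<Rightarrow> nat set \<Rightarrow> nat" where
  "rank G A = Max (card ` {S \<in> G. S \<subseteq> A})"

definition Ind :: "nat set set \<Rightarrow> nat set \<Rightarrow> bool" where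
  "Ind G B \<longleftrightarrow> B \<in> G"

text \<open>
  The children of a query node are indexed by answer vectors; only those whose length is the
  number of queried sets matter.
\<close>

datatype dtree =
    Leaf "nat set"
  | Rand "dtree list"
  | Query "nat set list" "bool list \<Rightarrow> dtree"

primrec decision_tree :: "nat \<Rightarrow> nat \<Rightarrow> dtree \<Rightarrow> bool" where
  "decision_tree m q (Leaf A) \<longleftrightarrow> A \<subseteq> {1..m}"
| "decision_tree m q (Rand ts) \<longleftrightarrow> ts \<noteq> [] \<and> list_all (\<lambda>b. b) (map (decision_tree m q) ts)"
| "decision_tree m q (Query Bs f) \<longleftrightarrow> length Bs = q \<and> (\<forall>B\<in>set Bs. B \<subseteq> {1..m}) \<and>
     (\<forall>as. length as = q \<longrightarrow> decision_tree m q (f as))"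

text \<open>Labels of the leaves at the end of root-to-leaf paths consistent with \<open>G\<close>.\<close>

primrec consistent_leaves :: "nat set set \<Rightarrow> dtree \<Rightarrow> nat set set" where
  "consistent_leaves G (Leaf A) = {A}"
| "consistent_leaves G (Rand ts) = \<Union> (set (map (consistent_leaves G) ts))"
| "consistent_leaves G (Query Bs f) = consistent_leaves G (f (map (Ind G) Bs))"

definition solves_spanning_forest :: "nat \<Rightarrow> dtree \<Rightarrow> bool" where
  "solves_spanning_forest m H \<longleftrightarrow>
     (\<forall>G. graphic_matroid m G \<longrightarrow>
        (\<forall>A\<in>consistent_leaves G H. A \<in> G \<and> rank G A = rank G {1..m}))"

text \<open>
  Distribution of the number of query nodes on the random root-to-leaf path taken on input
  \<open>G\<close>; randomization nodes do not count.
\<close>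

primrec depth_pmf :: "nat set set \<Rightarrow> dtree \<Rightarrow> nat pmf" where
  "depth_pmf G (Leaf A) = return_pmf 0"
| "depth_pmf G (Rand ts) =
     bind_pmf (pmf_of_set {..<length ts}) (\<lambda>i. map (depth_pmf G) ts ! i)"
| "depth_pmf G (Query Bs f) = map_pmf Suc (depth_pmf G (f (map (Ind G) Bs)))"

definition expected_depth :: "dtree \<Rightarrow> nat set set \<Rightarrow> real" where
  "expected_depth H G = measure_pmf.expectation (depth_pmf G H) real"

definition worst_depth :: "dtree \<Rightarrow> nat \<Rightarrow> real" where
  "worst_depth H m = Max (expected_depth H ` {G. graphic_matroid m G})"

lemma finite_graphic_matroids: "finite {G. graphic_matroid m G}"
  by (rule finite_subset[of _ "Pow (Pow {1..m})"]) (auto simp: graphic_matroid_def)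

lemma graphic_matroids_nonempty: "{G. graphic_matroid m G} \<noteq> {}"
  by (auto simp: graphic_matroid_def)

text \<open>
  The minimum is taken in the extended reals, so that it is \<open>\<infinity>\<close> if no tree of
  parallelism \<open>q\<close> solves the problem (as happens for \<open>q = 0\<close> and \<open>m > 0\<close>).
\<close>

definition T_ind_prob :: "nat \<Rightarrow> nat \<Rightarrow> ereal" where
  "T_ind_prob m q =
     (INF H \<in> {H. decision_tree m q H \<and> solves_spanning_forest m H}. ereal (worst_depth H m))"

end

theory Submission
  imports Defs "HOL-Real_Asymp.Real_Asymp"
begin

text \<open>
  The hard inputs are random disjoint unions of cycles, arranged in \<open>L = \<Theta>(log m)\<close> levels of
  \<open>n \<approx> m^(1/4)\<close> cycles each.  An edge lies in row \<open>i\<close> of level \<open>k\<close> with probability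
  \<open>K^k m^(-1/2)\<close>, independently, and it belongs to the cycle of the first row that contains it; an edge in
  no row is a coloop.  A set \<open>B\<close> is independent iff its complement meets every cycle.  Given the rows
  of the levels below \<open>k\<close>, a small complement is avoided by some cycle of level \<open>k\<close> and a large one
  meets all deeper cycles, because these have density at least \<open>K\<close> times larger.  So a round of
  queries reveals a single level up to an error \<open>q \<delta>\<close> with \<open>\<delta> = m^(-c-2)\<close>, and before the last level is
  revealed the leaf is wrong with high probability.  Averaging over the inputs yields a fixed input
  on which the tree asks at least \<open>L\<close> queries with probability at least one half.
\<close>

subsection \<open>Independent events of a product distribution\<close>

text \<open>The coordinates inside and outside \<open>S\<close> are independent, so gluing the
  \<open>S\<close> part of one sample \<open>w\<close> to the rest of a second, independent sample
  \<open>v\<close> reproduces the law. This replaces conditioning on the coordinates in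
  \<open>S\<close>.\<close>

lemma Pi_pmf_resample:
  assumes "finite I"
  shows "Pi_pmf I d p =
    bind_pmf (Pi_pmf I d p) (\<lambda>w. map_pmf (\<lambda>v. override_on v w S) (Pi_pmf I d p))"
proof -
  let ?P = "Pi_pmf I d p"
  let ?A = "I \<inter> S" and ?B = "I - S"
  have "?P = Pi_pmf (?A \<union> ?B) d p"
    by (simp add: Int_Diff_Un)
  also have "\<dots> = map_pmf (\<lambda>(f,g) x. if x \<in> ?A then f x else g x)
      (pair_pmf (Pi_pmf ?A d p) (Pi_pmf ?B d p))"
    using assms by (intro Pi_pmf_union) auto
  also have "\<dots> = map_pmf (\<lambda>(w,v) x. if x \<in> ?A then w x else if x \<in> ?B then v x else d)
      (pair_pmf ?P ?P)"
  proof -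
    have "Pi_pmf ?A d p = map_pmf (\<lambda>w x. if x \<in> ?A then w x else d) ?P"
      "Pi_pmf ?B d p = map_pmf (\<lambda>v x. if x \<in> ?B then v x else d) ?P"
      by (rule Pi_pmf_subset[OF assms]; blast)+
    then have eq: "pair_pmf (Pi_pmf ?A d p) (Pi_pmf ?B d p) =
        map_pmf (\<lambda>(w,v). (\<lambda>x. if x \<in> ?A then w x else d, \<lambda>x. if x \<in> ?B then v x else d))
          (pair_pmf ?P ?P)"
      by (simp only: map_pair)
    show ?thesis
      unfolding eq pmf.map_comp by (rule map_pmf_cong[OF refl]) (auto simp: fun_eq_iff)
  qed
  also have "\<dots> = map_pmf (\<lambda>(w,v). override_on v w S) (pair_pmf ?P ?P)"
  \<comment> \<open>Outside \<open>I\<close> both samples equal \<open>d\<close> on the support, so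
    the explicit default agrees with \<open>override_on\<close>.\<close>
  proof (rule map_pmf_cong[OF refl])
    fix z assume "z \<in> set_pmf (pair_pmf ?P ?P)"
    moreover obtain w v where z: "z = (w, v)" by (cases z)
    ultimately have "w x = d" "v x = d" if "x \<notin> I" for x
      using set_Pi_pmf_subset[OF assms, of d p] that by auto
    then show "(case z of (w,v) \<Rightarrow> \<lambda>x. if x \<in> ?A then w x else if x \<in> ?B then v x else d) =
        (case z of (w,v) \<Rightarrow> override_on v w S)"
      by (auto simp: z override_on_def fun_eq_iff)
  qed
  also have "\<dots> = bind_pmf ?P (\<lambda>w. map_pmf (\<lambda>v. override_on v w S) ?P)"
    by (simp add: pair_pmf_def map_pmf_def bind_assoc_pmf bind_return_pmf)
  finally show ?thesis .
qed

lemma finite_set_Pi_pmf: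
  fixes p :: "'a \<Rightarrow> 'b::finite pmf"
  assumes "finite I"
  shows "finite (set_pmf (Pi_pmf I d p))"
  using assms by (simp add: set_Pi_pmf finite_PiE_dflt)

text \<open>Tower property: draw the coordinates in \<open>S\<close> first, then average over the
  others. The support is finite, so the expectation of the mixture is a finite sum.\<close>

lemma expectation_Pi_pmf_resample:
  fixes p :: "'a \<Rightarrow> 'b::finite pmf" and d :: 'b and h :: "('a \<Rightarrow> 'b) \<Rightarrow> real"
  assumes "finite I"
  defines "P \<equiv> Pi_pmf I d p"
  shows "measure_pmf.expectation P h =
    measure_pmf.expectation P (\<lambda>w. measure_pmf.expectation P (\<lambda>v. h (override_on v w S)))"
proof -
  have fin: "finite (set_pmf P)"
    unfolding P_def by (rule finite_set_Pi_pmf[OF assms(1)])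
  have "P = bind_pmf P (\<lambda>w. map_pmf (\<lambda>v. override_on v w S) P)"
    unfolding P_def by (rule Pi_pmf_resample[OF assms(1)])
  then have "measure_pmf.expectation P h =
    measure_pmf.expectation (bind_pmf P (\<lambda>w. map_pmf (\<lambda>v. override_on v w S) P)) h"
    by (rule arg_cong)
  also have "\<dots> = (\<Sum>w\<in>set_pmf P. pmf P w *\<^sub>R
      measure_pmf.expectation (map_pmf (\<lambda>v. override_on v w S) P) h)"
    using fin by (intro pmf_expectation_bind) auto
  also have "\<dots> = (\<Sum>w\<in>set_pmf P. pmf P w *
      measure_pmf.expectation P (\<lambda>v. h (override_on v w S)))"
    by simp
  also have "\<dots> = measure_pmf.expectation P
      (\<lambda>w. measure_pmf.expectation P (\<lambda>v. h (override_on v w S)))"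
    by (subst (2) integral_measure_pmf_real[OF fin]) (auto simp: mult.commute)
  finally show ?thesis .
qed

lemma prob_expectation:
  "measure_pmf.prob p A = measure_pmf.expectation p (\<lambda>x. of_bool (x \<in> A) :: real)"
proof -
  have "(\<lambda>x. of_bool (x \<in> A) :: real) = indicator A"
    by (auto simp: indicator_def)
  then show ?thesis by simp
qed

text \<open>After resampling, \<open>Q\<close> sees only \<open>w\<close> and \<open>R\<close> sees
  only \<open>v\<close>, so the double expectation factors.\<close>

lemma prob_Pi_pmf_conj:
  fixes p :: "'a \<Rightarrow> 'b::finite pmf"
  assumes "finite I"
    and Q: "\<And>x y. (\<And>z. z \<in> S \<Longrightarrow> x z = y z) \<Longrightarrow> Q x = Q y"
    and R: "\<And>x y. (\<And>z. z \<notin> S \<Longrightarrow> x z = y z) \<Longrightarrow> R x = R y"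
  shows "measure_pmf.prob (Pi_pmf I d p) {x. Q x \<and> R x} =
    measure_pmf.prob (Pi_pmf I d p) {x. Q x} * measure_pmf.prob (Pi_pmf I d p) {x. R x}"
proof -
  let ?P = "Pi_pmf I d p"
  have [simp]: "Q (override_on v w S) = Q w" "R (override_on v w S) = R v" for v w
    by (auto intro!: Q R simp: override_on_def)
  show ?thesis
    unfolding prob_expectation
    by (subst expectation_Pi_pmf_resample[OF assms(1), where S = S])
      (simp add: of_bool_conj mult.commute)
qed

text \<open>Induction on \<open>J\<close>: the new event depends on the block \<open>D j\<close>,
  the remaining ones only on its complement because the blocks are disjoint.\<close>

lemma prob_Pi_pmf_Ball:
  fixes p :: "'a \<Rightarrow> 'b::finite pmf"
  assumes "finite I" "finite J" "disjoint_family_on D J"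
    and Q: "\<And>j x y. j \<in> J \<Longrightarrow> (\<And>z. z \<in> D j \<Longrightarrow> x z = y z) \<Longrightarrow> Q j x = Q j y"
  shows "measure_pmf.prob (Pi_pmf I d p) {x. \<forall>j\<in>J. Q j x} =
    (\<Prod>j\<in>J. measure_pmf.prob (Pi_pmf I d p) {x. Q j x})"
  using assms(2-)
proof (induction J rule: finite_induct)
  case empty
  then show ?case by simp
next
  case (insert j J)
  have "measure_pmf.prob (Pi_pmf I d p) {x. Q j x \<and> (\<forall>i\<in>J. Q i x)} =
    measure_pmf.prob (Pi_pmf I d p) {x. Q j x} * measure_pmf.prob (Pi_pmf I d p) {x. \<forall>i\<in>J. Q i x}"
  proof (rule prob_Pi_pmf_conj[OF assms(1), where S = "D j"])
    fix x y :: "'a \<Rightarrow> 'b" assume "\<And>z. z \<in> D j \<Longrightarrow> x z = y z"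
    then show "Q j x = Q j y" by (intro insert.prems(2)) auto
  next
    fix x y :: "'a \<Rightarrow> 'b" assume eq: "\<And>z. z \<notin> D j \<Longrightarrow> x z = y z"
    have "Q i x = Q i y" if "i \<in> J" for i
    proof (rule insert.prems(2))
      have "D i \<inter> D j = {}"
        using insert.prems(1) insert.hyps(2) that by (auto simp: disjoint_family_on_def)
      then show "\<And>z. z \<in> D i \<Longrightarrow> x z = y z" using eq by blast
    qed (use that in auto)
    then show "(\<forall>i\<in>J. Q i x) = (\<forall>i\<in>J. Q i y)" by simp
  qed
  also have "measure_pmf.prob (Pi_pmf I d p) {x. \<forall>i\<in>J. Q i x} =
      (\<Prod>i\<in>J. measure_pmf.prob (Pi_pmf I d p) {x. Q i x})"
  proof (rule insert.IH)
    show "disjoint_family_on D J"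
      using insert.prems(1) by (auto simp: disjoint_family_on_def)
  qed (rule insert.prems(2), auto)
  finally show ?case
    using insert.hyps by simp
qed

subsection \<open>Graphic matroids with disjoint circuits\<close>

text \<open>Cyclic successor in the increasing enumeration of \<open>C\<close>:
  \<open>inv_into\<close> recovers the position of \<open>e\<close>, and the last element is
  followed by the first.\<close>

definition next_in :: "nat set \<Rightarrow> nat \<Rightarrow> nat" where
  "next_in C e = (let l = sorted_list_of_set C
     in l ! (Suc (inv_into {..<length l} ((!) l) e) mod length l))"

lemma next_in_nth:
  assumes "i < length (sorted_list_of_set C)"
  shows "next_in C (sorted_list_of_set C ! i) =
    sorted_list_of_set C ! (Suc i mod length (sorted_list_of_set C))"
proof -
  have "inj_on ((!) (sorted_list_of_set C)) {..<length (sorted_list_of_set C)}"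
    by (auto simp: inj_on_def nth_eq_iff_index_eq)
  then show ?thesis
    using assms by (simp add: next_in_def Let_def inv_into_f_f)
qed

lemma in_finite_set_nth:
  assumes "finite C" "e \<in> C"
  obtains i where "i < length (sorted_list_of_set C)" "e = sorted_list_of_set C ! i"
  using assms by (metis in_set_conv_nth set_sorted_list_of_set)

lemma next_in_mem:
  assumes "finite C" "e \<in> C"
  shows "next_in C e \<in> C"
proof -
  from assms obtain i where i: "i < length (sorted_list_of_set C)" "e = sorted_list_of_set C ! i"
    by (rule in_finite_set_nth)
  then have "Suc i mod length (sorted_list_of_set C) < length (sorted_list_of_set C)"
    by (intro mod_less_divisor) linarith
  then show ?thesis
    using i next_in_nth assms(1) by (metis nth_mem set_sorted_list_of_set)
qed

lemma Suc_mod_inject: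
  assumes "Suc i mod n = Suc j mod n" "i < n" "j < n"
  shows "i = j"
  using assms by (auto simp: mod_Suc split: if_splits)

lemma inj_on_next_in:
  assumes "finite C"
  shows "inj_on (next_in C) C"
proof (rule inj_onI)
  fix x y assume xy: "x \<in> C" "y \<in> C" "next_in C x = next_in C y"
  let ?l = "sorted_list_of_set C"
  obtain i where i: "i < length ?l" "x = ?l ! i"
    using in_finite_set_nth[OF assms xy(1)] .
  obtain j where j: "j < length ?l" "y = ?l ! j"
    using in_finite_set_nth[OF assms xy(2)] .
  have "Suc i mod length ?l < length ?l" "Suc j mod length ?l < length ?l"
    using i(1) by (auto intro!: mod_less_divisor)
  moreover have "?l ! (Suc i mod length ?l) = ?l ! (Suc j mod length ?l)"
    using xy(3) i j by (simp add: next_in_nth)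
  ultimately have "Suc i mod length ?l = Suc j mod length ?l"
    by (simp add: nth_eq_iff_index_eq)
  then show "x = y"
    using Suc_mod_inject i j by blast
qed

text \<open>Iterating the cyclic successor from any one element reaches all of
  \<open>C\<close>.\<close>

lemma next_in_closed_superset:
  assumes "finite C" "e \<in> C" "e \<in> A" and closed: "\<And>x. x \<in> C \<Longrightarrow> x \<in> A \<Longrightarrow> next_in C x \<in> A"
  shows "C \<subseteq> A"
proof
  fix x assume "x \<in> C"
  let ?l = "sorted_list_of_set C"
  obtain i where i: "i < length ?l" "e = ?l ! i"
    using in_finite_set_nth[OF assms(1,2)] .
  obtain j where j: "j < length ?l" "x = ?l ! j"
    using in_finite_set_nth[OF assms(1) \<open>x \<in> C\<close>] .
  have "?l ! ((i + k) mod length ?l) \<in> A" for k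
  proof (induction k)
    case 0
    then show ?case using i assms(3) by simp
  next
    case (Suc k)
    have lt: "(i + k) mod length ?l < length ?l"
      using i(1) by (intro mod_less_divisor) linarith
    then have "?l ! ((i + k) mod length ?l) \<in> C"
      using assms(1) by (metis nth_mem set_sorted_list_of_set)
    from closed[OF this Suc] show ?case
      using lt by (simp add: next_in_nth mod_Suc_eq)
  qed
  \<comment> \<open>Adding the length keeps the natural subtraction exact when \<open>j < i\<close>;
    modulo the length this many steps lead from \<open>i\<close> to \<open>j\<close>.\<close>
  from this[of "length ?l + j - i"] show "x \<in> A"
    using i j by simp
qed

text \<open>Edge labels double as vertices: edge \<open>e\<close> will join \<open>e\<close> to its
  successor. A class then closes up to a cycle, while an edge outside all classes ends in a fresh
  vertex above \<open>m\<close> and becomes a coloop.\<close>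

definition succ_edge :: "nat \<Rightarrow> nat set set \<Rightarrow> nat \<Rightarrow> nat" where
  "succ_edge m \<C> e =
     (if e \<in> \<Union>\<C> then next_in (THE C. C \<in> \<C> \<and> e \<in> C) e else e + m)"

lemma succ_edge_in_class:
  assumes "disjoint \<C>" "C \<in> \<C>" "e \<in> C"
  shows "succ_edge m \<C> e = next_in C e"
proof -
  have "(THE C. C \<in> \<C> \<and> e \<in> C) = C"
    using assms by (intro the_equality) (auto simp: disjoint_def)
  then show ?thesis
    using assms by (auto simp: succ_edge_def)
qed

text \<open>The value locates its argument: for an edge of a class it stays in that class, hence is
  at most \<open>m\<close>; for the other edges it exceeds \<open>m\<close>. In each case the
  successor is injective.\<close>

lemma inj_on_succ_edge:
  assumes "disjoint \<C>" "\<And>C. C \<in> \<C> \<Longrightarrow> C \<subseteq> {1..m}"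
  shows "inj_on (succ_edge m \<C>) {1..m}"
proof (rule inj_onI)
  fix x y assume xy: "x \<in> {1..m}" "y \<in> {1..m}" "succ_edge m \<C> x = succ_edge m \<C> y"
  have fin: "finite C" if "C \<in> \<C>" for C
    using assms(2)[OF that] finite_subset by blast
  have in_class: "succ_edge m \<C> z \<in> C" if "C \<in> \<C>" "z \<in> C" for C z
    using succ_edge_in_class[OF assms(1) that] next_in_mem[OF fin] that by simp
  have le: "succ_edge m \<C> z \<le> m \<longleftrightarrow> z \<in> \<Union>\<C>" if "z \<in> {1..m}" for z
  proof
    assume "z \<in> \<Union>\<C>"
    then show "succ_edge m \<C> z \<le> m"
      using in_class assms(2) by (meson UnionE atLeastAtMost_iff subsetD)
  qed (use that in \<open>auto simp: succ_edge_def split: if_splits\<close>)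
  show "x = y"
  proof (cases "x \<in> \<Union>\<C>")
    case True
    then have "y \<in> \<Union>\<C>"
      using le xy by metis
    with True obtain C D where CD: "C \<in> \<C>" "D \<in> \<C>" "x \<in> C" "y \<in> D" by blast
    then have "C = D"
      using in_class[of C x] in_class[of D y] xy(3) assms(1) by (auto simp: disjoint_def)
    then show ?thesis
      using CD xy(3) inj_on_next_in[OF fin, of C] succ_edge_in_class[OF assms(1)]
      by (metis inj_onD)
  next
    case False
    then have "y \<notin> \<Union>\<C>"
      using le xy by metis
    then show ?thesis
      using False xy(3) by (simp add: succ_edge_def)
  qed
qed

text \<open>
  Each vertex of a cycle of length at least 2 meets two of its edges, but the vertex \<open>s e\<close> meets
  only the edges \<open>e\<close> and \<open>s e\<close>.
\<close>

lemma is_cycle_closed: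
  assumes cyc: "is_cycle (\<lambda>e. (e, s e)) A" and inj: "inj_on s A" and "e \<in> A"
  shows "s e \<in> A"
proof -
  obtain vs es where ne: "es \<noteq> []" and len: "length vs = length es" and dist: "distinct es"
    and A: "set es = A"
    and J: "\<And>i. i < length es \<Longrightarrow>
      joins (\<lambda>e. (e, s e)) (es ! i) (vs ! i) (vs ! (Suc i mod length es))"
    using cyc unfolding is_cycle_def by blast
  let ?n = "length es"
  obtain i where i: "i < ?n" "e = es ! i"
    using \<open>e \<in> A\<close> A by (metis in_set_conv_nth)
  have ends: "(vs ! k = es ! k \<and> vs ! (Suc k mod ?n) = s (es ! k)) \<or>
      (vs ! k = s (es ! k) \<and> vs ! (Suc k mod ?n) = es ! k)" if "k < ?n" for k
    using J[OF that] by (auto simp: joins_def)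
  have "Suc i mod ?n < ?n"
    using i by (intro mod_less_divisor) linarith
  then obtain j where j: "j < ?n" "vs ! j = s e"
    using ends[OF i(1)] i by metis
  have mem: "es ! k \<in> A" if "k < ?n" for k
    using A that by auto
  show ?thesis
  proof (cases "?n = 1")
    case True
    then show ?thesis using ends[of 0] i mem[of 0] by auto
  next
    case False
    then have n: "?n > 1" using ne by (cases es) auto
    \<comment> \<open>\<open>k\<close> is the cyclic predecessor of \<open>j\<close>, so the edges
      at positions \<open>k\<close> and \<open>j\<close> are the two cycle edges at the vertex
      \<open>s e\<close>.\<close>
    obtain k where k: "k < ?n" "Suc k mod ?n = j" "k \<noteq> j"
    proof (cases j)
      case 0
      moreover have "Suc (?n - 1) = ?n" using n by linarith
      ultimately have "Suc (?n - 1) mod ?n = j" "?n - 1 < ?n" "?n - 1 \<noteq> j"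
        using n by (simp_all only: mod_self)
      then show ?thesis using that by blast
    next
      case (Suc k)
      then show ?thesis using j that[of k] by auto
    qed
    have "es ! k \<noteq> es ! j"
      using k j dist by (simp add: nth_eq_iff_index_eq)
    \<comment> \<open>By injectivity at most one of these two edges has successor
      \<open>s e\<close>; the other has \<open>s e\<close> as its first end, hence is the edge
      \<open>s e\<close> itself.\<close>
    then have "\<not> (s (es ! k) = s e \<and> s (es ! j) = s e)"
      using inj mem[OF k(1)] mem[OF j(1)] by (metis inj_onD)
    moreover have "s e \<in> {es ! k, s (es ! k)}" "s e \<in> {es ! j, s (es ! j)}"
      using ends[OF k(1)] ends[OF j(1)] k(2) j(2) by auto
    ultimately show ?thesis
      using mem[OF k(1)] mem[OF j(1)] by auto
  qed
qed

text \<open>With edge \<open>e\<close> joining \<open>e\<close> to its successor, every class is a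
  cycle. Conversely a cycle within \<open>{1..m}\<close> is closed under successors; this excludes
  edges outside the classes, so the cycle contains a whole class.\<close>

lemma graphic_matroid_disjoint_circuits:
  assumes disj: "disjoint \<C>" and ne: "{} \<notin> \<C>" and sub: "\<And>C. C \<in> \<C> \<Longrightarrow> C \<subseteq> {1..m}"
  shows "graphic_matroid m {S. S \<subseteq> {1..m} \<and> (\<forall>C\<in>\<C>. \<not> C \<subseteq> S)}"
proof -
  let ?s = "succ_edge m \<C>"
  let ?ends = "\<lambda>e. (e, ?s e)"
  have fin: "finite C" if "C \<in> \<C>" for C
    using sub[OF that] finite_subset by blast
  have class_cycle: "is_cycle ?ends C" if C: "C \<in> \<C>" for C
  proof -
    let ?l = "sorted_list_of_set C"
    have "?l \<noteq> []" using fin[OF C] ne C by auto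
    moreover have "joins ?ends (?l ! i) (?l ! i) (?l ! (Suc i mod length ?l))"
      if "i < length ?l" for i
    proof -
      have "?l ! i \<in> C" using that fin[OF C] by (metis nth_mem set_sorted_list_of_set)
      then show ?thesis
        using succ_edge_in_class[OF disj C] next_in_nth[OF that] by (simp add: joins_def)
    qed
    ultimately show ?thesis
      unfolding is_cycle_def using fin[OF C]
      by (intro exI[of _ ?l]) (auto simp del: length_sorted_list_of_set)
  qed
  have class_in_cycle: "\<exists>C\<in>\<C>. C \<subseteq> A" if cyc: "is_cycle ?ends A" and A: "A \<subseteq> {1..m}" for A
  proof -
    have closed: "?s e \<in> A" if "e \<in> A" for e
      using is_cycle_closed[OF cyc inj_on_subset[OF inj_on_succ_edge[OF disj sub] A] that] .
    obtain e where e: "e \<in> A"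
      using cyc unfolding is_cycle_def by fastforce
    have "e \<in> \<Union>\<C>"
    proof (rule ccontr)
      assume "e \<notin> \<Union>\<C>"
      then have "?s e = e + m" by (simp add: succ_edge_def)
      moreover have "?s e \<in> {1..m}" "e \<in> {1..m}" using closed[OF e] e A by blast+
      ultimately show False by simp
    qed
    then obtain C where C: "C \<in> \<C>" "e \<in> C" by blast
    have "C \<subseteq> A"
      using fin[OF C(1)] C(2) e
    proof (rule next_in_closed_superset)
      fix x assume "x \<in> C" "x \<in> A"
      then show "next_in C x \<in> A"
        using closed succ_edge_in_class[OF disj C(1)] by metis
    qed
    then show ?thesis using C(1) by blast
  qed
  have "acyclic_edges ?ends S \<longleftrightarrow> (\<forall>C\<in>\<C>. \<not> C \<subseteq> S)" if "S \<subseteq> {1..m}" for S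
    unfolding acyclic_edges_def using class_cycle class_in_cycle that by (meson subset_trans)
  then show ?thesis
    unfolding graphic_matroid_def by (intro exI[of _ ?ends]) auto
qed

subsection \<open>Classes of an incidence matrix\<close>

text \<open>The first-row rule makes the classes disjoint, while class \<open>i\<close> depends on
  the rows up to \<open>i\<close> only, so rows can be revealed in order.\<close>

definition cls :: "nat \<Rightarrow> (nat \<times> nat \<Rightarrow> bool) \<Rightarrow> nat \<Rightarrow> nat set" where
  "cls m X i = {e \<in> {1..m}. X (i, e) \<and> (\<forall>j<i. \<not> X (j, e))}"

text \<open>An empty class makes this family empty, and then it is not a matroid.\<close>

definition indep_fam :: "nat \<Rightarrow> nat \<Rightarrow> (nat \<times> nat \<Rightarrow> bool) \<Rightarrow> nat set set" where
  "indep_fam m N X = {S. S \<subseteq> {1..m} \<and> (\<forall>i<N. \<not> cls m X i \<subseteq> S)}"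

lemma cls_disjoint: "i \<noteq> j \<Longrightarrow> cls m X i \<inter> cls m X j = {}"
  by (cases i j rule: linorder_cases) (auto simp: cls_def)

lemma cls_cong:
  "(\<And>j e. j \<le> i \<Longrightarrow> X (j, e) = Y (j, e)) \<Longrightarrow> cls m X i = cls m Y i"
  by (auto simp: cls_def)

lemma graphic_indep_fam:
  assumes "\<forall>i<N. cls m X i \<noteq> {}"
  shows "graphic_matroid m (indep_fam m N X)"
proof -
  have "graphic_matroid m {S. S \<subseteq> {1..m} \<and> (\<forall>C\<in>cls m X ` {..<N}. \<not> C \<subseteq> S)}"
  proof (rule graphic_matroid_disjoint_circuits)
    show "disjoint (cls m X ` {..<N})"
    proof (rule disjointI)
      fix A B assume "A \<in> cls m X ` {..<N}" "B \<in> cls m X ` {..<N}" "A \<noteq> B"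
      moreover from this obtain i j where "A = cls m X i" "B = cls m X j" by blast
      ultimately show "A \<inter> B = {}" using cls_disjoint[of i j m X] by blast
    qed
    show "{} \<notin> cls m X ` {..<N}"
    proof
      assume "{} \<in> cls m X ` {..<N}"
      then obtain i where "i < N" "cls m X i = {}" by (auto elim!: imageE dest: sym)
      with assms show False by simp
    qed
    show "C \<subseteq> {1..m}" if "C \<in> cls m X ` {..<N}" for C
    proof -
      from that obtain i where "C = cls m X i" by blast
      then show ?thesis by (auto simp: cls_def)
    qed
  qed
  moreover have "(\<forall>C\<in>cls m X ` {..<N}. \<not> C \<subseteq> S) \<longleftrightarrow> (\<forall>i<N. \<not> cls m X i \<subseteq> S)" for S
    by blast
  ultimately show ?thesis by (simp only: indep_fam_def)
qed

text \<open>Deleting one representative per class leaves an independent set with at least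
  \<open>m - N\<close> elements, so the full rank forces \<open>card A\<close> to be that
  large.\<close>

lemma card_complement_basis_le:
  assumes ne: "\<forall>i<N. cls m X i \<noteq> {}" and A: "A \<in> indep_fam m N X"
    and rank: "rank (indep_fam m N X) A = rank (indep_fam m N X) {1..m}"
  shows "card ({1..m} - A) \<le> N"
proof -
  let ?G = "indep_fam m N X"
  have fin: "finite (card ` {S \<in> ?G. S \<subseteq> B})" for B
    by (intro finite_imageI finite_subset[of "{S \<in> ?G. S \<subseteq> B}" "Pow {1..m}"])
      (auto simp: indep_fam_def)
  have AE: "A \<subseteq> {1..m}" using A by (simp add: indep_fam_def)
  define x where "x i = (SOME e. e \<in> cls m X i)" for i
  have x: "x i \<in> cls m X i" if "i < N" for i
    using ne that by (simp add: x_def some_in_eq)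
  let ?S = "{1..m} - x ` {..<N}"
  have "?S \<in> ?G"
    using x by (auto simp: indep_fam_def)
  then have "card ?S \<le> rank ?G {1..m}"
    unfolding rank_def by (intro Max_ge fin) auto
  also have "\<dots> = rank ?G A" using rank by simp
  also have "\<dots> \<le> card A"
    unfolding rank_def using A finite_subset[OF AE]
    by (subst Max_le_iff[OF fin]) (auto intro: card_mono)
  finally have "card ?S \<le> card A" .
  moreover have "m - N \<le> card ?S"
    using diff_card_le_card_Diff[of "x ` {..<N}" "{1..m}"] card_image_le[of "{..<N}" x] by simp
  moreover have "card ({1..m} - A) = m - card A"
    using AE by (simp add: card_Diff_subset finite_subset)
  ultimately show ?thesis by linarith
qed

section \<open>Success and depth of a decision tree on a fixed input\<close>

text \<open>
  For \<open>N\<close> disjoint circuits, \<open>card ({1..m} - A) \<le> N\<close> is all that is used of the full rank of \<open>A\<close>.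
\<close>

primrec succ_prob :: "nat \<Rightarrow> nat \<Rightarrow> nat set set \<Rightarrow> dtree \<Rightarrow> nat \<Rightarrow> real" where
  "succ_prob m N G (Leaf A) = (\<lambda>d. of_bool (A \<in> G \<and> card ({1..m} - A) \<le> N))"
| "succ_prob m N G (Rand ts) =
     (\<lambda>d. (\<Sum>i<length ts. (map (succ_prob m N G) ts ! i) d) / real (length ts))"
| "succ_prob m N G (Query Bs f) =
     (\<lambda>d. if d = 0 then 0 else succ_prob m N G (f (map (Ind G) Bs)) (d - 1))"

lemma succ_prob_bounds: "0 \<le> succ_prob m N G H d \<and> succ_prob m N G H d \<le> 1"
proof (induction H arbitrary: d)
  case (Rand ts)
  have *: "0 \<le> (map (succ_prob m N G) ts ! i) d \<and> (map (succ_prob m N G) ts ! i) d \<le> 1"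
    if "i < length ts" for i
    using Rand[of "ts ! i" d] that by simp
  have "(\<Sum>i<length ts. (map (succ_prob m N G) ts ! i) d) \<le> (\<Sum>i<length ts. 1)"
    using * by (intro sum_mono) simp
  then show ?case
    using * by (auto intro!: sum_nonneg divide_nonneg_nonneg simp: divide_le_eq_1)
qed auto

lemma finite_set_depth_pmf: "decision_tree m q H \<Longrightarrow> finite (set_pmf (depth_pmf G H))"
proof (induction H)
  case (Rand ts)
  then show ?case
    by (subst depth_pmf.simps) (auto simp: list_all_iff set_pmf_of_set lessThan_empty_iff)
next
  case (Query Bs f)
  then show ?case by auto
qed auto

text \<open>If all reachable leaves are correct, succeeding with budget \<open>d\<close> just means
  meeting at most \<open>d\<close> query nodes. Bounds on success thus become bounds on the
  depth.\<close>

lemma prob_depth_eq_succ_prob: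
  assumes "decision_tree m q H"
    and "\<forall>A\<in>consistent_leaves G H. A \<in> G \<and> card ({1..m} - A) \<le> N"
  shows "measure_pmf.prob (depth_pmf G H) {..d} = succ_prob m N G H d"
  using assms
proof (induction H arbitrary: d)
  case (Leaf A)
  then show ?case by simp
next
  case (Rand ts)
  have IH: "measure_pmf.prob (depth_pmf G (ts ! i)) {..d} = succ_prob m N G (ts ! i) d"
    if "i < length ts" for i
    using Rand that by (intro Rand.IH) (auto simp: list_all_iff)
  have ts: "ts \<noteq> []" using Rand.prems by simp
  have "measure_pmf.prob (depth_pmf G (Rand ts)) {..d} =
    measure_pmf.expectation (pmf_of_set {..<length ts} \<bind> (\<lambda>i. map (depth_pmf G) ts ! i))
      (\<lambda>x. of_bool (x \<in> {..d}))"
    by (simp add: prob_expectation)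
  also have "\<dots> = (\<Sum>i<length ts. measure_pmf.expectation (map (depth_pmf G) ts ! i)
      (\<lambda>x. of_bool (x \<in> {..d})) /\<^sub>R real (card {..<length ts}))"
  proof (rule pmf_expectation_bind_pmf_of_set)
    show "finite (set_pmf (map (depth_pmf G) ts ! i))" if "i \<in> {..<length ts}" for i
      using finite_set_depth_pmf[of m q "ts ! i"] Rand.prems(1) that by (auto simp: list_all_iff)
  qed (use ts in \<open>auto simp: lessThan_empty_iff\<close>)
  also have "\<dots> = (\<Sum>i<length ts. succ_prob m N G (ts ! i) d / real (length ts))"
    by (intro sum.cong refl) (simp add: IH[symmetric] prob_expectation divide_inverse mult.commute)
  also have "\<dots> = succ_prob m N G (Rand ts) d"
    by (simp add: sum_divide_distrib)
  finally show ?case .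
next
  case (Query Bs f)
  let ?H = "f (map (Ind G) Bs)"
  have IH: "measure_pmf.prob (depth_pmf G ?H) {..d'} = succ_prob m N G ?H d'" for d'
    using Query.prems by (intro Query.IH) auto
  have "Suc -` {..d} = (if d = 0 then {} else {..d - 1})" by auto
  then show ?case by (simp add: IH)
qed

text \<open>Markov's inequality at the threshold \<open>d + 1\<close>, the depth being an
  integer.\<close>

lemma expected_depth_ge:
  assumes "decision_tree m q H"
  shows "real (Suc d) * (1 - measure_pmf.prob (depth_pmf G H) {..d}) \<le> expected_depth H G"
proof -
  let ?D = "depth_pmf G H"
  have fin: "finite (set_pmf ?D)" by (rule finite_set_depth_pmf[OF assms])
  have "1 - measure_pmf.prob ?D {..d} = measure_pmf.prob ?D (UNIV - {..d})"
    using measure_pmf.prob_compl[of "{..d}" ?D] by simp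
  then have "real (Suc d) * (1 - measure_pmf.prob ?D {..d}) =
      measure_pmf.expectation ?D (\<lambda>x. real (Suc d) * of_bool (x \<in> UNIV - {..d}))"
    by (simp add: prob_expectation)
  also have "\<dots> \<le> expected_depth H G"
    unfolding expected_depth_def
    by (intro integral_mono integrable_measure_pmf_finite fin) auto
  finally show ?thesis .
qed

subsection \<open>Random inputs\<close>

definition incidence_pmf :: "(nat \<Rightarrow> real) \<Rightarrow> nat \<Rightarrow> nat \<Rightarrow> (nat \<times> nat \<Rightarrow> bool) pmf" where
  "incidence_pmf p N m = Pi_pmf ({..<N} \<times> {1..m}) False (\<lambda>(i, e). bernoulli_pmf (p i))"

text \<open>Rows stand in for classes: dropping the first-row condition only enlarges the event and
  keeps the rows independent.\<close>

definition all_meet :: "nat set \<Rightarrow> nat set \<Rightarrow> (nat \<times> nat \<Rightarrow> bool) set" where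
  "all_meet T I = {v. \<forall>i\<in>I. \<exists>e\<in>T. v (i, e)}"

text \<open>Earlier rows are tested only from \<open>a\<close> on, since rows below \<open>a\<close>
  will be fixed and \<open>T\<close> chosen to avoid them.\<close>

definition some_misses :: "nat set \<Rightarrow> nat \<Rightarrow> nat set \<Rightarrow> (nat \<times> nat \<Rightarrow> bool) set" where
  "some_misses T a I = {v. \<exists>i\<in>I. \<forall>e\<in>T. \<not> (v (i, e) \<and> (\<forall>j\<in>{a..<i}. \<not> v (j, e)))}"

text \<open>State of knowledge after some rounds: \<open>u\<close> supplies the rows already
  revealed, \<open>v\<close> is a fresh sample for the others.\<close>

definition fix_rows :: "nat \<Rightarrow> (nat \<times> nat \<Rightarrow> bool) \<Rightarrow> (nat \<times> nat \<Rightarrow> bool) \<Rightarrow> nat \<times> nat \<Rightarrow> bool" where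
  "fix_rows a u v = override_on v u ({..<a} \<times> UNIV)"

lemma fix_rows_apply: "fix_rows a u v (i, e) = (if i < a then u (i, e) else v (i, e))"
  by (simp add: fix_rows_def override_on_def)

lemma fix_rows_fix_rows:
  assumes "a \<le> b"
  shows "fix_rows a u (fix_rows b w v) = fix_rows b (fix_rows a u w) v"
  using assms by (auto simp: fun_eq_iff fix_rows_apply)

lemma finite_set_incidence_pmf: "finite (set_pmf (incidence_pmf p N m))"
  unfolding incidence_pmf_def by (rule finite_set_Pi_pmf) simp

lemma expectation_incidence_fix_rows:
  fixes h :: "(nat \<times> nat \<Rightarrow> bool) \<Rightarrow> real"
  shows "measure_pmf.expectation (incidence_pmf p N m) h =
    measure_pmf.expectation (incidence_pmf p N m) (\<lambda>w.
      measure_pmf.expectation (incidence_pmf p N m) (\<lambda>v. h (fix_rows a w v)))"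
  unfolding incidence_pmf_def fix_rows_def
  by (rule expectation_Pi_pmf_resample) simp

lemma prob_mono: "A \<subseteq> B \<Longrightarrow> measure_pmf.prob p A \<le> measure_pmf.prob p B"
  by (rule measure_pmf.finite_measure_mono) simp_all

lemma expectation_mono_finite:
  fixes f g :: "'a \<Rightarrow> real"
  assumes "finite (set_pmf P)" "\<And>x. f x \<le> g x"
  shows "measure_pmf.expectation P f \<le> measure_pmf.expectation P g"
  using assms by (intro integral_mono integrable_measure_pmf_finite) auto

lemma expectation_le_const:
  fixes f :: "'a \<Rightarrow> real"
  assumes "finite (set_pmf P)" "\<And>x. f x \<le> c"
  shows "measure_pmf.expectation P f \<le> c"
  using expectation_mono_finite[OF assms(1), of f "\<lambda>_. c"] assms(2) by simp

section \<open>Revealing one level per query round\<close>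

text \<open>
  A query is decided, up to probability \<open>\<delta>\<close>, by the rows up to level \<open>k\<close>: with \<open>T\<close> the set of
  elements that neither \<open>B\<close> nor an earlier row contains, either \<open>T\<close> is so small that some class of
  level \<open>k\<close> misses it, or so large that all deeper classes meet it.
\<close>

lemma query_predictable:
  assumes level: "Suc k * n \<le> N"
    and sep: "\<And>T. T \<subseteq> {1..m} \<Longrightarrow>
      measure_pmf.prob (incidence_pmf p N m) (all_meet T {k * n..<Suc k * n}) \<le> \<delta> \<or>
      measure_pmf.prob (incidence_pmf p N m) (some_misses T (k * n) {Suc k * n..<N}) \<le> \<delta>"
    and B: "B \<subseteq> {1..m}"
  shows "\<exists>g. (\<forall>w v. g (fix_rows (Suc k * n) w v) = g w) \<and>
    measure_pmf.prob (incidence_pmf p N m)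
      {v. Ind (indep_fam m N (fix_rows (k * n) u v)) B \<noteq> g (fix_rows (k * n) u v)} \<le> \<delta>"
proof -
  let ?P = "incidence_pmf p N m"
  let ?X = "fix_rows (k * n) u"
  have \<delta>: "0 \<le> \<delta>"
    using sep[of "{}"] measure_nonneg order_trans by blast
  have kn: "k * n \<le> Suc k * n" by simp
  have Ind: "Ind (indep_fam m N X) B \<longleftrightarrow> (\<forall>i<N. \<not> cls m X i \<subseteq> B)" for X
    using B by (simp add: Ind_def indep_fam_def)
  have cls_low: "cls m (?X v) i = cls m u i" if "i < k * n" for v i
    using that by (intro cls_cong) (simp add: fix_rows_apply)
  show ?thesis
  proof (cases "\<exists>i<k * n. cls m u i \<subseteq> B")
    \<comment> \<open>A revealed class already lies in \<open>B\<close>, so the answer is known to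
      be negative.\<close>
    case True
    then obtain i where i: "i < k * n" "cls m u i \<subseteq> B" by blast
    then have "\<not> Ind (indep_fam m N (?X v)) B" for v
      unfolding Ind using cls_low[OF i(1)] level kn by (metis order_less_le_trans)
    then show ?thesis
      using \<delta> by (intro exI[of _ "\<lambda>_. False"]) simp
  next
    case False
    define T where "T = {e \<in> {1..m} - B. \<forall>j<k * n. \<not> u (j, e)}"
    have cls_high: "cls m (?X v) i \<subseteq> B \<longleftrightarrow>
        (\<forall>e\<in>T. \<not> (v (i, e) \<and> (\<forall>j\<in>{k * n..<i}. \<not> v (j, e))))" if "k * n \<le> i" for v i
    proof -
      have "(\<forall>j<i. \<not> ?X v (j, e)) \<longleftrightarrow>
          (\<forall>j<k * n. \<not> u (j, e)) \<and> (\<forall>j\<in>{k * n..<i}. \<not> v (j, e))" for e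
        using that by (auto simp: fix_rows_apply not_less dest: order_less_le_trans)
      then show ?thesis
        using that unfolding cls_def T_def by (auto simp: fix_rows_apply)
    qed
    have "T \<subseteq> {1..m}" by (auto simp: T_def)
    from sep[OF this] show ?thesis
    proof
      \<comment> \<open>Small \<open>T\<close>: independence would need all classes of level
        \<open>k\<close> to meet \<open>T\<close>, which is unlikely, so the prediction is
        constantly negative.\<close>
      assume le: "measure_pmf.prob ?P (all_meet T {k * n..<Suc k * n}) \<le> \<delta>"
      have "{v. Ind (indep_fam m N (?X v)) B \<noteq> False} \<subseteq> all_meet T {k * n..<Suc k * n}"
      proof
        fix v assume "v \<in> {v. Ind (indep_fam m N (?X v)) B \<noteq> False}"
        then have "\<not> cls m (?X v) i \<subseteq> B" if "i < N" for i
          using that Ind by simp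
        then have "\<exists>e\<in>T. v (i, e)" if "i \<in> {k * n..<Suc k * n}" for i
          using that level cls_high[of i v]
          by (meson atLeastLessThan_iff order_less_le_trans)
        then show "v \<in> all_meet T {k * n..<Suc k * n}"
          unfolding all_meet_def by blast
      qed
      then have "measure_pmf.prob ?P {v. Ind (indep_fam m N (?X v)) B \<noteq> False} \<le> \<delta>"
        using le prob_mono order_trans by blast
      then show ?thesis
        by (intro exI[of _ "\<lambda>_. False"]) simp
    next
      assume le: "measure_pmf.prob ?P (some_misses T (k * n) {Suc k * n..<N}) \<le> \<delta>"
      \<comment> \<open>Large \<open>T\<close>: no revealed class lies in \<open>B\<close>, and all
        deeper classes probably meet \<open>T\<close>, so level \<open>k\<close> alone decides the
        answer.\<close>
      define g where "g X \<longleftrightarrow> (\<forall>i\<in>{k * n..<Suc k * n}. \<not> cls m X i \<subseteq> B)" for X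
      have "cls m (fix_rows (Suc k * n) w v) i = cls m w i" if "i < Suc k * n" for w v i
        using that by (intro cls_cong) (simp add: fix_rows_apply)
      then have g: "\<forall>w v. g (fix_rows (Suc k * n) w v) = g w"
        by (simp add: g_def)
      have "{v. Ind (indep_fam m N (?X v)) B \<noteq> g (?X v)} \<subseteq>
          some_misses T (k * n) {Suc k * n..<N}"
      proof
        fix v assume "v \<in> {v. Ind (indep_fam m N (?X v)) B \<noteq> g (?X v)}"
        then have neq: "Ind (indep_fam m N (?X v)) B \<noteq> g (?X v)" by simp
        have "g (?X v)" if "Ind (indep_fam m N (?X v)) B"
          using that level unfolding Ind g_def by auto
        then have "\<not> Ind (indep_fam m N (?X v)) B" "g (?X v)"
          using neq by auto
        then obtain i where i: "i < N" "cls m (?X v) i \<subseteq> B"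
          unfolding Ind by blast
        have "\<not> i < k * n" using False cls_low i(2) by metis
        moreover have "i \<notin> {k * n..<Suc k * n}"
          using \<open>g (?X v)\<close> i(2) unfolding g_def by blast
        ultimately have "Suc k * n \<le> i" by simp
        then show "v \<in> some_misses T (k * n) {Suc k * n..<N}"
          using cls_high[of i v] i kn unfolding some_misses_def by auto
      qed
      then have "measure_pmf.prob ?P {v. Ind (indep_fam m N (?X v)) B \<noteq> g (?X v)} \<le> \<delta>"
        using le prob_mono order_trans by blast
      then show ?thesis using g by blast
    qed
  qed
qed


text \<open>If the true answers equal the prediction \<open>as\<close>, the tree follows
  \<open>f as\<close>; otherwise some term of the sum is 1, which exceeds no less than any success
  probability.\<close>

lemma succ_prob_mismatch:
  assumes len: "length as = length Bs"
  shows "succ_prob m N G (f (map (Ind G) Bs)) d \<le>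
    (\<Sum>i<length Bs. of_bool (Ind G (Bs ! i) \<noteq> as ! i)) + succ_prob m N G (f as) d"
proof (cases "map (Ind G) Bs = as")
  case True
  then show ?thesis by (simp add: sum_nonneg)
next
  case False
  then obtain i where i: "i < length Bs" "Ind G (Bs ! i) \<noteq> as ! i"
    using len by (auto simp: list_eq_iff_nth_eq)
  have "(1::real) = of_bool (Ind G (Bs ! i) \<noteq> as ! i)"
    using i(2) by (simp only: of_bool_eq not_False_eq_True simp_thms)
  also have "\<dots> \<le> (\<Sum>i<length Bs. of_bool (Ind G (Bs ! i) \<noteq> as ! i))"
    using i(1) by (intro member_le_sum) auto
  finally show ?thesis
    using succ_prob_bounds[of m N G "f (map (Ind G) Bs)" d] succ_prob_bounds[of m N G "f as" d]
    by linarith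
qed

text \<open>Induction on the tree for all revealed rows \<open>u\<close>. A query round reveals
  level \<open>k\<close> and costs \<open>q * \<delta>\<close> for wrong predictions;
  \<open>k + d < L\<close> keeps a level unrevealed when a leaf is reached, and the small complement
  of its label then meets all classes of that level with probability at most
  \<open>\<delta>\<close>.\<close>

lemma expected_succ_prob_le:
  assumes levels: "L * n \<le> N"
    and sep: "\<And>k T. k < L \<Longrightarrow> T \<subseteq> {1..m} \<Longrightarrow>
      measure_pmf.prob (incidence_pmf p N m) (all_meet T {k * n..<Suc k * n}) \<le> \<delta> \<or>
      measure_pmf.prob (incidence_pmf p N m) (some_misses T (k * n) {Suc k * n..<N}) \<le> \<delta>"
    and small: "\<And>k T. k < L \<Longrightarrow> T \<subseteq> {1..m} \<Longrightarrow> card T \<le> N \<Longrightarrow>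
      measure_pmf.prob (incidence_pmf p N m) (all_meet T {k * n..<Suc k * n}) \<le> \<delta>"
    and "decision_tree m q H" "k + d < L"
  shows "measure_pmf.expectation (incidence_pmf p N m)
      (\<lambda>v. succ_prob m N (indep_fam m N (fix_rows (k * n) u v)) H d) \<le> (real q * real d + 1) * \<delta>"
  using assms(4,5)
proof (induction H arbitrary: k d u)
  case (Leaf A)
  let ?P = "incidence_pmf p N m"
  have k: "k < L" using Leaf by simp
  have \<delta>: "0 \<le> \<delta>"
    by (rule order_trans[OF measure_nonneg small[OF k, of "{}"]]) simp_all
  \<comment> \<open>Elements of a later class lie in no revealed row, so only \<open>T\<close> can
    keep a class of level \<open>k\<close> from being contained in \<open>A\<close>.\<close>
  define T where "T = {e \<in> {1..m} - A. \<forall>j<k * n. \<not> u (j, e)}"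
  have level: "Suc k * n \<le> N"
    using mult_le_mono1[OF Suc_leI[OF k], of n] levels by (rule order_trans)
  have "measure_pmf.expectation ?P
      (\<lambda>v. succ_prob m N (indep_fam m N (fix_rows (k * n) u v)) (Leaf A) d) \<le> \<delta>"
  proof (cases "card ({1..m} - A) \<le> N")
    case False
    then show ?thesis using \<delta> by simp
  next
    case True
    have "card T \<le> card ({1..m} - A)"
      by (intro card_mono) (auto simp: T_def)
    then have "measure_pmf.prob ?P (all_meet T {k * n..<Suc k * n}) \<le> \<delta>"
      using True Leaf by (intro small) (auto simp: T_def)
    moreover have "v \<in> all_meet T {k * n..<Suc k * n}"
      if A: "A \<in> indep_fam m N (fix_rows (k * n) u v)" for v
      unfolding all_meet_def
    proof clarify
      fix i assume i: "i \<in> {k * n..<Suc k * n}"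
      then have "\<not> cls m (fix_rows (k * n) u v) i \<subseteq> A"
        using A level by (simp add: indep_fam_def)
      then obtain e where e: "e \<in> {1..m} - A" "fix_rows (k * n) u v (i, e)"
        "\<forall>j<i. \<not> fix_rows (k * n) u v (j, e)"
        by (auto simp: cls_def)
      have "\<not> u (j, e)" if "j < k * n" for j
        using e(3)[rule_format, of j] i that by (simp add: fix_rows_apply)
      moreover have "v (i, e)"
        using e(2) i by (simp add: fix_rows_apply)
      ultimately show "\<exists>e\<in>T. v (i, e)"
        using e(1) by (auto simp: T_def)
    qed
    then have "measure_pmf.expectation ?P
        (\<lambda>v. succ_prob m N (indep_fam m N (fix_rows (k * n) u v)) (Leaf A) d) \<le>
        measure_pmf.prob ?P (all_meet T {k * n..<Suc k * n})"
      unfolding prob_expectation by (intro expectation_mono_finite finite_set_incidence_pmf) auto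
    ultimately show ?thesis by linarith
  qed
  also have "\<delta> \<le> (real q * real d + 1) * \<delta>"
    using \<delta> by (simp add: mult_le_cancel_right2 algebra_simps)
  finally show ?case .
next
  case (Rand ts)
  let ?P = "incidence_pmf p N m"
  let ?G = "\<lambda>v. indep_fam m N (fix_rows (k * n) u v)"
  let ?b = "(real q * real d + 1) * \<delta>"
  have int: "integrable ?P F" for F :: "_ \<Rightarrow> real"
    by (intro integrable_measure_pmf_finite finite_set_incidence_pmf)
  have "measure_pmf.expectation ?P (\<lambda>v. succ_prob m N (?G v) (Rand ts) d) =
      (\<Sum>i<length ts. measure_pmf.expectation ?P (\<lambda>v. succ_prob m N (?G v) (ts ! i) d)) /
        real (length ts)"
    by (simp add: Bochner_Integration.integral_sum int)
  also have "\<dots> \<le> (\<Sum>i<length ts. ?b) / real (length ts)"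
    using Rand by (intro divide_right_mono sum_mono Rand.IH) (auto simp: list_all_iff)
  also have "\<dots> = ?b"
    using Rand.prems(1) by simp
  finally show ?case .
next
  case (Query Bs f)
  let ?P = "incidence_pmf p N m"
  let ?E = "measure_pmf.expectation ?P"
  let ?G = "\<lambda>u v. indep_fam m N (fix_rows (k * n) u v)"
  have k: "k < L" using Query.prems by simp
  have \<delta>: "0 \<le> \<delta>"
    by (rule order_trans[OF measure_nonneg small[OF k, of "{}"]]) simp_all
  have level: "Suc k * n \<le> N"
    using mult_le_mono1[OF Suc_leI[OF k], of n] levels by (rule order_trans)
  have Bs: "length Bs = q" "\<And>B. B \<in> set Bs \<Longrightarrow> B \<subseteq> {1..m}"
    "\<And>as. length as = q \<Longrightarrow> decision_tree m q (f as)"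
    using Query.prems by auto
  show ?case
  proof (cases d)
    case 0
    then show ?thesis using \<delta> by simp
  next
    case (Suc d')
    have "\<exists>g. (\<forall>w v. g (fix_rows (Suc k * n) w v) = g w) \<and>
        measure_pmf.prob ?P {v. Ind (?G u v) B \<noteq> g (fix_rows (k * n) u v)} \<le> \<delta>"
      if "B \<in> set Bs" for B
      using Query.prems Bs(2)[OF that] sep by (intro query_predictable level) auto
    then have "\<forall>B\<in>set Bs. \<exists>g. (\<forall>w v. g (fix_rows (Suc k * n) w v) = g w) \<and>
        measure_pmf.prob ?P {v. Ind (?G u v) B \<noteq> g (fix_rows (k * n) u v)} \<le> \<delta>"
      by (intro ballI)
    from bchoice[OF this]
    obtain g where "\<forall>B\<in>set Bs. (\<forall>w v. g B (fix_rows (Suc k * n) w v) = g B w) \<and>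
        measure_pmf.prob ?P {v. Ind (?G u v) B \<noteq> g B (fix_rows (k * n) u v)} \<le> \<delta>"
      by (rule exE)
    note G = bspec[OF this]
    have g: "g B (fix_rows (Suc k * n) w v) = g B w" if "B \<in> set Bs" for B w v
      using G[OF that] by (elim conjE allE)
    have mis: "measure_pmf.prob ?P {v. Ind (?G u v) B \<noteq> g B (fix_rows (k * n) u v)} \<le> \<delta>"
      if "B \<in> set Bs" for B
      using G[OF that] by (rule conjunct2)
    \<comment> \<open>\<open>h\<close> counts wrong predictions; \<open>s\<close> is the success
      along the predicted branch.\<close>
    define h :: "_ \<Rightarrow> real" where "h v = (\<Sum>i<q. of_bool (Ind (?G u v) (Bs ! i) \<noteq>
      g (Bs ! i) (fix_rows (k * n) u v)))" for v
    define s where "s v = succ_prob m N (?G u v)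
      (f (map (\<lambda>B. g B (fix_rows (k * n) u v)) Bs)) d'" for v
    have int: "integrable ?P F" for F :: "_ \<Rightarrow> real"
      by (intro integrable_measure_pmf_finite finite_set_incidence_pmf)
    have h: "?E h \<le> real q * \<delta>"
    proof -
      have "?E h = (\<Sum>i<q. measure_pmf.prob ?P
          {v. Ind (?G u v) (Bs ! i) \<noteq> g (Bs ! i) (fix_rows (k * n) u v)})"
        unfolding h_def prob_expectation mem_Collect_eq
        by (rule Bochner_Integration.integral_sum) (rule int)
      also have "\<dots> \<le> (\<Sum>i<q. \<delta>)"
        using Bs(1) by (intro sum_mono mis) auto
      finally show ?thesis by simp
    qed
    have s: "?E s \<le> (real q * real d' + 1) * \<delta>"
    proof -
      \<comment> \<open>Once the rows of level \<open>k\<close> are fixed to those of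
        \<open>w\<close>, the predicted answers are constant in \<open>v\<close>, so the induction
        hypothesis applies to one subtree at level \<open>k + 1\<close>.\<close>
      have "?E (\<lambda>v. s (fix_rows (Suc k * n) w v)) \<le> (real q * real d' + 1) * \<delta>" for w
      proof -
        let ?u = "fix_rows (k * n) u w"
        let ?as = "map (\<lambda>B. g B ?u) Bs"
        have eq: "fix_rows (k * n) u (fix_rows (Suc k * n) w v) = fix_rows (Suc k * n) ?u v" for v
          by (rule fix_rows_fix_rows) simp
        have "s (fix_rows (Suc k * n) w v) =
            succ_prob m N (indep_fam m N (fix_rows (Suc k * n) ?u v)) (f ?as) d'" for v
          unfolding s_def eq using g by (simp cong: map_cong)
        then show ?thesis
          using Query.prems Suc Bs by (simp only:) (intro Query.IH, auto)
      qed
      then show ?thesis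
        by (subst expectation_incidence_fix_rows[of _ _ _ _ "Suc k * n"])
          (rule expectation_le_const[OF finite_set_incidence_pmf])
    qed
    have "?E (\<lambda>v. succ_prob m N (?G u v) (Query Bs f) d) \<le> ?E (\<lambda>v. h v + s v)"
    proof (rule expectation_mono_finite[OF finite_set_incidence_pmf])
      fix v
      show "succ_prob m N (?G u v) (Query Bs f) d \<le> h v + s v"
        using succ_prob_mismatch[of "map (\<lambda>B. g B (fix_rows (k * n) u v)) Bs" Bs m N "?G u v" f d']
        unfolding h_def s_def by (simp add: Suc Bs(1))
    qed
    also have "\<dots> = ?E h + ?E s"
      by (intro Bochner_Integration.integral_add int)
    also have "\<dots> \<le> (real q * real d + 1) * \<delta>"
      using h s by (simp add: Suc algebra_simps)
    finally show ?thesis .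
  qed
qed

subsection \<open>Bounds for a single query\<close>

lemma prob_incidence:
  assumes "i < N" "e \<in> {1..m}" "0 \<le> p i" "p i \<le> 1"
  shows "measure_pmf.prob (incidence_pmf p N m) {v. v (i, e)} = p i"
proof -
  let ?P = "incidence_pmf p N m"
  have "measure_pmf.prob ?P {v. v (i, e)} = measure_pmf.prob (map_pmf (\<lambda>v. v (i, e)) ?P) {True}"
    by (simp add: vimage_def)
  also have "map_pmf (\<lambda>v. v (i, e)) ?P = bernoulli_pmf (p i)"
    using assms(1,2) unfolding incidence_pmf_def by (subst Pi_pmf_component) auto
  finally show ?thesis
    using assms(3,4) by (simp add: measure_pmf_single)
qed

lemma prob_not: "measure_pmf.prob P {x. \<not> Q x} = 1 - measure_pmf.prob P {x. Q x}"
  using measure_pmf.prob_compl[of "{x. Q x}" P] by (simp add: Compl_eq_Diff_UNIV[symmetric] Collect_neg_eq)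

text \<open>All entries are independent: a row misses \<open>T\<close> with probability
  \<open>(1 - r) ^ card T\<close>, and distinct rows do so independently.\<close>

lemma prob_all_meet:
  assumes I: "I \<subseteq> {..<N}" and T: "T \<subseteq> {1..m}" and p: "\<And>i. i \<in> I \<Longrightarrow> p i = r"
    and r: "0 \<le> r" "r \<le> 1"
  shows "measure_pmf.prob (incidence_pmf p N m) (all_meet T I) = (1 - (1 - r) ^ card T) ^ card I"
proof -
  let ?P = "incidence_pmf p N m"
  have fin: "finite I" "finite T" using I T finite_subset by auto
  have row: "measure_pmf.prob ?P {v. \<exists>e\<in>T. v (i, e)} = 1 - (1 - r) ^ card T" if i: "i \<in> I" for i
  proof -
    have "measure_pmf.prob ?P {v. \<forall>e\<in>T. \<not> v (i, e)} =
        (\<Prod>e\<in>T. measure_pmf.prob ?P {v. \<not> v (i, e)})"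
      unfolding incidence_pmf_def
      by (rule prob_Pi_pmf_Ball[where D = "\<lambda>e. {(i, e)}"])
        (use fin in \<open>auto simp: disjoint_family_on_def\<close>)
    also have "\<dots> = (\<Prod>e\<in>T. 1 - r)"
    proof (rule prod.cong[OF refl])
      fix e assume "e \<in> T"
      then have "i < N" "e \<in> {1..m}" "p i = r" using i I T p by auto
      then show "measure_pmf.prob ?P {v. \<not> v (i, e)} = 1 - r"
        using prob_incidence[of i N e m p] r by (simp add: prob_not)
    qed
    finally show ?thesis
      using prob_not[of ?P "\<lambda>v. \<exists>e\<in>T. v (i, e)"] by simp
  qed
  have "measure_pmf.prob ?P (all_meet T I) = (\<Prod>i\<in>I. measure_pmf.prob ?P {v. \<exists>e\<in>T. v (i, e)})"
    unfolding incidence_pmf_def all_meet_def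
    by (rule prob_Pi_pmf_Ball[where D = "\<lambda>i. {i} \<times> UNIV"])
      (use fin in \<open>auto simp: disjoint_family_on_def\<close>)
  also have "\<dots> = (1 - (1 - r) ^ card T) ^ card I"
    by (simp add: row)
  finally show ?thesis .
qed

text \<open>An element lies in row \<open>i\<close> but in none of the rows from \<open>a\<close> to
  \<open>i - 1\<close> with probability at least \<open>r / 2\<close>, because all densities sum to
  at most 1/2. Distinct elements have independent columns.\<close>

lemma prob_row_misses:
  assumes i: "i < N" and T: "T \<subseteq> {1..m}" and p: "\<And>j. 0 \<le> p j" "\<And>j. j < N \<Longrightarrow> p j \<le> 1"
    and sum: "sum p {..<N} \<le> 1/2" and r: "r \<le> p i"
  shows "measure_pmf.prob (incidence_pmf p N m)
    {v. \<forall>e\<in>T. \<not> (v (i, e) \<and> (\<forall>j\<in>{a..<i}. \<not> v (j, e)))} \<le> (1 - r / 2) ^ card T"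
proof -
  let ?P = "incidence_pmf p N m"
  let ?Q = "\<lambda>e v. v (i, e) \<and> (\<forall>j\<in>{a..<i}. \<not> v (j, e))"
  have fin: "finite T" using T finite_subset by auto
  have col: "r / 2 \<le> measure_pmf.prob ?P {v. ?Q e v}" if e: "e \<in> T" for e
  proof -
    let ?R = "\<lambda>j v. if j = i then v (i, e) else \<not> v (j, e)"
    have single: "measure_pmf.prob ?P {v. ?R j v} = (if j = i then p i else 1 - p j)" if "j < N" for j
      using prob_incidence[of j N e m p] prob_not[of ?P "\<lambda>v. v (j, e)"] that p e T by auto
    have "{v. ?Q e v} = {v. \<forall>j\<in>insert i {a..<i}. ?R j v}"
      by auto
    then have "measure_pmf.prob ?P {v. ?Q e v} =
        measure_pmf.prob ?P {v. \<forall>j\<in>insert i {a..<i}. ?R j v}"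
      by (rule arg_cong)
    also have "\<dots> = (\<Prod>j\<in>insert i {a..<i}. measure_pmf.prob ?P {v. ?R j v})"
      unfolding incidence_pmf_def
      by (rule prob_Pi_pmf_Ball[where D = "\<lambda>j. {(j, e)}"])
        (auto simp: disjoint_family_on_def)
    also have "\<dots> = (\<Prod>j\<in>insert i {a..<i}. if j = i then p i else 1 - p j)"
      using i by (intro prod.cong refl single) auto
    also have "\<dots> = p i * (\<Prod>j\<in>{a..<i}. 1 - p j)"
      by (subst prod.insert) (auto intro!: arg_cong2[where f = "(*)"] prod.cong)
    finally have "measure_pmf.prob ?P {v. ?Q e v} = p i * (\<Prod>j\<in>{a..<i}. 1 - p j)" .
    moreover have "1 / 2 \<le> (\<Prod>j\<in>{a..<i}. 1 - p j)"
    proof -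
      have "sum p {a..<i} \<le> sum p {..<N}"
        using i p by (intro sum_mono2) auto
      moreover have "1 - sum p {a..<i} \<le> (\<Prod>j\<in>{a..<i}. 1 - p j)"
        using i p by (intro Weierstrass_prod_ineq) auto
      ultimately show ?thesis using sum by linarith
    qed
    ultimately have "p i * (1 / 2) \<le> measure_pmf.prob ?P {v. ?Q e v}"
      using p(1)[of i] by (simp only:) (intro mult_left_mono)
    then show ?thesis using r by simp
  qed
  have "measure_pmf.prob ?P {v. \<forall>e\<in>T. \<not> ?Q e v} = (\<Prod>e\<in>T. measure_pmf.prob ?P {v. \<not> ?Q e v})"
    unfolding incidence_pmf_def
    by (rule prob_Pi_pmf_Ball[where D = "\<lambda>e. UNIV \<times> {e}"])
      (use fin in \<open>auto simp: disjoint_family_on_def\<close>)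
  also have "\<dots> \<le> (\<Prod>e\<in>T. 1 - r / 2)"
  proof (intro prod_mono conjI)
    fix e assume "e \<in> T"
    then show "measure_pmf.prob ?P {v. \<not> ?Q e v} \<le> 1 - r / 2"
      using col[of e] prob_not[of ?P "?Q e"] by simp
  qed simp
  finally show ?thesis by simp
qed

text \<open>Union bound over the rows, with \<open>1 - r / 2 \<le> exp (- (r / 2))\<close>;
  \<open>r \<le> 2\<close> keeps the base of the power nonnegative.\<close>

lemma prob_some_misses:
  assumes I: "I \<subseteq> {..<N}" and T: "T \<subseteq> {1..m}"
    and p: "\<And>j. 0 \<le> p j" "\<And>j. j < N \<Longrightarrow> p j \<le> 1"
    and sum: "sum p {..<N} \<le> 1/2" and r: "\<And>i. i \<in> I \<Longrightarrow> r \<le> p i" "r \<le> 2"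
  shows "measure_pmf.prob (incidence_pmf p N m) (some_misses T a I) \<le>
    real N * exp (- (r * card T / 2))"
proof -
  let ?P = "incidence_pmf p N m"
  let ?A = "\<lambda>i. {v. \<forall>e\<in>T. \<not> (v (i, e) \<and> (\<forall>j\<in>{a..<i}. \<not> v (j, e)))}"
  have fin: "finite I" using I finite_subset by auto
  have exp: "(1 - r / 2) ^ card T \<le> exp (- (r * card T / 2))"
  proof -
    have "(1 - r / 2) ^ card T \<le> exp (- (r / 2)) ^ card T"
      using exp_ge_add_one_self[of "- (r / 2)"] r(2) by (intro power_mono) auto
    also have "\<dots> = exp (- (r * card T / 2))"
      by (simp add: exp_of_nat_mult[symmetric] algebra_simps)
    finally show ?thesis .
  qed
  have "measure_pmf.prob ?P (some_misses T a I) = measure_pmf.prob ?P (\<Union>i\<in>I. ?A i)"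
    by (rule arg_cong[where f = "measure_pmf.prob ?P"]) (auto simp: some_misses_def)
  also have "\<dots> \<le> (\<Sum>i\<in>I. measure_pmf.prob ?P (?A i))"
    by (rule measure_pmf.finite_measure_subadditive_finite) (use fin in auto)
  also have "\<dots> \<le> (\<Sum>i\<in>I. exp (- (r * card T / 2)))"
  proof (rule sum_mono)
    fix i assume "i \<in> I"
    then have "measure_pmf.prob ?P (?A i) \<le> (1 - r / 2) ^ card T"
      using I r by (intro prob_row_misses T p sum) auto
    then show "measure_pmf.prob ?P (?A i) \<le> exp (- (r * card T / 2))"
      using exp by linarith
  qed
  also have "\<dots> = real (card I) * exp (- (r * card T / 2))"
    by simp
  also have "\<dots> \<le> real N * exp (- (r * card T / 2))"
    using card_mono[OF finite_lessThan I] by (intro mult_right_mono) auto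
  finally show ?thesis .
qed

text \<open>For \<open>x \<le> 1/2\<close> one has
  \<open>ln (1 - x) \<ge> - x - 2 * x\<^sup>2 \<ge> - 2 * x\<close>.\<close>

lemma one_minus_power_ge_exp:
  fixes x :: real
  assumes "0 \<le> x" "x \<le> 1/2"
  shows "exp (- (2 * x * real t)) \<le> (1 - x) ^ t"
proof -
  have "2 * x\<^sup>2 \<le> x"
    using mult_left_mono[OF assms(2,1)] by (simp add: power2_eq_square)
  then have "- (2 * x) \<le> ln (1 - x)"
    using ln_one_minus_pos_lower_bound[OF assms] by linarith
  then have "exp (- (2 * x)) \<le> 1 - x"
    using assms by (subst (asm) ln_ge_iff) auto
  then have "exp (- (2 * x)) ^ t \<le> (1 - x) ^ t"
    by (intro power_mono) auto
  then show ?thesis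
    by (simp add: exp_of_nat_mult[symmetric] algebra_simps)
qed

subsection \<open>The lower bound\<close>

text \<open>\<open>r\<close> is the density of level 0 and \<open>K\<close> the ratio of successive
  densities. The threshold \<open>s\<close> on \<open>r * K ^ k * card T\<close>, the mean number of
  elements of \<open>T\<close> in a row of level \<open>k\<close>, separates small \<open>T\<close>
  (bounded by \<open>meet\<close>) from large \<open>T\<close> (bounded by
  \<open>miss\<close>).\<close>

lemma worst_depth_ge:
  fixes K r s \<delta> :: real
  assumes H: "decision_tree m q H" "solves_spanning_forest m H"
    and "0 < n" "0 < L" "1 \<le> K" "0 < r" and N: "N = L * n"
    and sparse: "real N * (r * K ^ (L - 1)) \<le> 1/2" and s: "1/2 \<le> s"
    and meet: "(1 - exp (- (2 * s))) ^ n \<le> \<delta>"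
    and miss: "real N * exp (- (K * s / 2)) \<le> \<delta>"
    and error: "(real q * real L + 1) * \<delta> \<le> 1/4"
    and nonempty: "real N * exp (- (r * real m / 2)) \<le> 1/4"
  shows "real L / 2 \<le> worst_depth H m"
proof -
  define p where "p i = r * K ^ (i div n)" for i
  let ?P = "incidence_pmf p N m"
  \<comment> \<open>After \<open>L - 1\<close> rounds one level is still hidden.\<close>
  define d where "d = L - 1"
  have level_lt: "i div n < L" if "i < N" for i
    using that unfolding N by (simp add: less_mult_imp_div_less)
  have p0: "0 \<le> p j" for j
    using \<open>0 < r\<close> \<open>1 \<le> K\<close> by (simp add: p_def)
  have rate: "r * K ^ k \<le> r * K ^ (L - 1)" if "k < L" for k
    using that \<open>0 < r\<close> \<open>1 \<le> K\<close> by (intro mult_left_mono power_increasing) auto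
  have "1 \<le> N" using \<open>0 < n\<close> \<open>0 < L\<close> by (simp add: N)
  then have "1 * (r * K ^ (L - 1)) \<le> real N * (r * K ^ (L - 1))"
    using \<open>0 < r\<close> \<open>1 \<le> K\<close> by (intro mult_right_mono) auto
  then have half: "r * K ^ k \<le> 1/2" if "k < L" for k
    using rate[OF that] sparse by linarith
  have p1: "p j \<le> 1" if "j < N" for j
    using half[OF level_lt[OF that]] by (simp add: p_def)
  have "sum p {..<N} \<le> (\<Sum>j<N. r * K ^ (L - 1))"
    unfolding p_def using level_lt by (intro sum_mono rate) auto
  then have sum_p: "sum p {..<N} \<le> 1/2" using sparse by simp
  have all_meet: "measure_pmf.prob ?P (all_meet T {k * n..<Suc k * n}) \<le> \<delta>"
    if k: "k < L" and T: "T \<subseteq> {1..m}" and le: "r * K ^ k * card T \<le> s" for k T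
  proof -
    have "Suc k * n \<le> N" using k unfolding N by (intro mult_le_mono1) simp
    then have "measure_pmf.prob ?P (all_meet T {k * n..<Suc k * n}) =
        (1 - (1 - r * K ^ k) ^ card T) ^ card {k * n..<Suc k * n}"
    proof (intro prob_all_meet T)
      fix i assume "i \<in> {k * n..<Suc k * n}"
      then have "i div n = k"
        by (intro div_nat_eqI) (auto simp: mult.commute)
      then show "p i = r * K ^ k" by (simp add: p_def)
    qed (use half[OF k] \<open>0 < r\<close> \<open>1 \<le> K\<close> in auto)
    also have "\<dots> \<le> (1 - exp (- (2 * s))) ^ n"
    proof -
      have "exp (- (2 * s)) \<le> exp (- (2 * (r * K ^ k) * card T))"
        using le by simp
      also have "\<dots> \<le> (1 - r * K ^ k) ^ card T"
        using half[OF k] \<open>0 < r\<close> \<open>1 \<le> K\<close> by (intro one_minus_power_ge_exp) auto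
      finally show ?thesis
        using half[OF k] \<open>0 < r\<close> \<open>1 \<le> K\<close> by (auto intro!: power_mono power_le_one)
    qed
    finally show ?thesis using meet by linarith
  qed
  have expected: "measure_pmf.expectation ?P
      (\<lambda>v. succ_prob m N (indep_fam m N (fix_rows (0 * n) (\<lambda>_. False) v)) H d) \<le>
      (real q * real d + 1) * \<delta>"
  proof (rule expected_succ_prob_le[where L = L])
    show "L * n \<le> N" by (simp add: N)
    show "decision_tree m q H" "0 + d < L" using H \<open>0 < L\<close> by (auto simp: d_def)
  next
    fix k T assume k: "k < L" and T: "T \<subseteq> {1..m}"
    show "measure_pmf.prob ?P (all_meet T {k * n..<Suc k * n}) \<le> \<delta> \<or>
        measure_pmf.prob ?P (some_misses T (k * n) {Suc k * n..<N}) \<le> \<delta>"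
    proof (cases "r * K ^ k * card T \<le> s")
      case True
      then show ?thesis using all_meet k T by blast
    next
      case False
      show ?thesis
      proof (cases "Suc k < L")
        case True
        have deep: "r * K ^ Suc k \<le> p i" if "i \<in> {Suc k * n..<N}" for i
        proof -
          have "Suc k \<le> i div n"
            using that \<open>0 < n\<close> by (simp add: less_eq_div_iff_mult_less_eq)
          then show ?thesis
            unfolding p_def using \<open>0 < r\<close> \<open>1 \<le> K\<close>
            by (intro mult_left_mono power_increasing) auto
        qed
        have "measure_pmf.prob ?P (some_misses T (k * n) {Suc k * n..<N}) \<le>
            real N * exp (- (r * K ^ Suc k * card T / 2))"
          using half[OF True] deep by (intro prob_some_misses T p0 p1 sum_p) auto
        also have "\<dots> \<le> real N * exp (- (K * s / 2))"
        proof -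
          have "K * s \<le> K * (r * K ^ k * card T)"
            using False \<open>1 \<le> K\<close> by (intro mult_left_mono) auto
          then show ?thesis
            by (intro mult_left_mono) (auto simp: algebra_simps)
        qed
        finally show ?thesis using miss by linarith
      next
        \<comment> \<open>Below the last level there are no rows, so the second alternative holds
          with probability 0.\<close>
        case False
        then have "N \<le> Suc k * n"
          unfolding N by (intro mult_le_mono1) simp
        then have "some_misses T (k * n) {Suc k * n..<N} = {}"
          by (auto simp: some_misses_def)
        moreover have "0 \<le> \<delta>"
          using miss by (rule order_trans[rotated]) simp
        ultimately show ?thesis by simp
      qed
    qed
    \<comment> \<open>Sets of at most \<open>N\<close> elements stay below the threshold even at the
      densest level, by \<open>sparse\<close> and \<open>1/2 \<le> s\<close>.\<close>
    assume "card T \<le> N"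
    then have "r * K ^ k * card T \<le> r * K ^ (L - 1) * N"
      using rate[OF k] \<open>0 < r\<close> \<open>1 \<le> K\<close> by (intro mult_mono) auto
    then have "r * K ^ k * card T \<le> s"
      using sparse s by (simp add: mult.commute)
    then show "measure_pmf.prob ?P (all_meet T {k * n..<Suc k * n}) \<le> \<delta>"
      using all_meet k T by blast
  qed
  have fix0: "fix_rows (0 * n) (\<lambda>_. False) v = v" for v
    by (auto simp: fun_eq_iff fix_rows_apply)
  have "0 \<le> \<delta>"
    using miss by (rule order_trans[rotated]) simp
  then have "(real q * real d + 1) * \<delta> \<le> (real q * real L + 1) * \<delta>"
    by (intro mult_right_mono add_mono mult_left_mono) (auto simp: d_def)
  then have expected: "measure_pmf.expectation ?P (\<lambda>v. succ_prob m N (indep_fam m N v) H d) \<le> 1/4"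
    using expected error unfolding fix0 by linarith
  let ?good = "\<lambda>v. \<forall>i<N. cls m v i \<noteq> {}"
  \<comment> \<open>An empty class is one that misses the whole ground set
    \<open>{1..m}\<close>.\<close>
  have "{v. \<not> ?good v} \<subseteq> some_misses {1..m} 0 {..<N}"
    by (fastforce simp: some_misses_def cls_def)
  then have "measure_pmf.prob ?P {v. \<not> ?good v} \<le>
      measure_pmf.prob ?P (some_misses {1..m} 0 {..<N})"
    by (rule prob_mono)
  also have "\<dots> \<le> real N * exp (- (r * real (card {1..m}) / 2))"
  proof (intro prob_some_misses p0 p1 sum_p)
    fix i assume "i \<in> {..<N}"
    show "r \<le> p i"
      using mult_left_mono[of 1 "K ^ (i div n)" r] \<open>0 < r\<close> \<open>1 \<le> K\<close> by (simp add: p_def)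
  qed (use half[of 0] \<open>0 < L\<close> in auto)
  also have "\<dots> \<le> 1/4" using nonempty by simp
  finally have good: "3/4 \<le> measure_pmf.prob ?P {v. ?good v}"
    unfolding prob_not by simp
  \<comment> \<open>Otherwise the mean success would be at least \<open>1/2 * 3/4 = 3/8\<close>,
    above the bound 1/4.\<close>
  have "\<exists>v. ?good v \<and> succ_prob m N (indep_fam m N v) H d \<le> 1/2"
  proof (rule ccontr)
    assume neg: "\<nexists>v. ?good v \<and> succ_prob m N (indep_fam m N v) H d \<le> 1/2"
    have "1/2 * of_bool (v \<in> {v. ?good v}) \<le> succ_prob m N (indep_fam m N v) H d" for v
    proof (cases "?good v")
      case True
      with neg have "\<not> succ_prob m N (indep_fam m N v) H d \<le> 1/2" by blast
      then show ?thesis by (auto simp: True)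
    next
      case False
      then have "v \<notin> {v. ?good v}" by simp
      then show ?thesis
        using succ_prob_bounds[of m N "indep_fam m N v" H d] by (simp only: of_bool_eq mult_zero_right)
    qed
    then have "measure_pmf.expectation ?P (\<lambda>v. 1/2 * of_bool (v \<in> {v. ?good v})) \<le>
        measure_pmf.expectation ?P (\<lambda>v. succ_prob m N (indep_fam m N v) H d)"
      by (intro expectation_mono_finite finite_set_incidence_pmf)
    then have "1/2 * measure_pmf.prob ?P {v. ?good v} \<le>
        measure_pmf.expectation ?P (\<lambda>v. succ_prob m N (indep_fam m N v) H d)"
      unfolding prob_expectation by simp
    then show False using good expected by linarith
  qed
  then obtain v where v: "?good v" "succ_prob m N (indep_fam m N v) H d \<le> 1/2"
    by blast
  let ?G = "indep_fam m N v"
  have G: "graphic_matroid m ?G" by (rule graphic_indep_fam[OF v(1)])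
  have "A \<in> ?G \<and> card ({1..m} - A) \<le> N" if "A \<in> consistent_leaves ?G H" for A
    using H(2) G that card_complement_basis_le[OF v(1)] unfolding solves_spanning_forest_def by blast
  then have "measure_pmf.prob (depth_pmf ?G H) {..d} \<le> 1/2"
    using prob_depth_eq_succ_prob[OF H(1), of ?G N d] v(2) by simp
  then have "real (Suc d) * (1/2) \<le> real (Suc d) * (1 - measure_pmf.prob (depth_pmf ?G H) {..d})"
    by (intro mult_left_mono) auto
  also have "\<dots> \<le> expected_depth H ?G" by (rule expected_depth_ge[OF H(1)])
  also have "\<dots> \<le> worst_depth H m"
    unfolding worst_depth_def using G by (intro Max_ge finite_imageI finite_graphic_matroids) simp
  finally show ?thesis using \<open>0 < L\<close> by (simp add: d_def)
qed

theorem mainTheorem3: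
  fixes c :: real
  assumes "c > 0"
  shows "\<exists>K>0. \<exists>m0. \<forall>m\<ge>m0. \<forall>q. real q \<le> real m powr c \<longrightarrow>
           ereal (K * ln (real m)) \<le> T_ind_prob m q"
proof -
  \<comment> \<open>Chosen so that \<open>K * s / 2 = (c + 3) * ln m\<close> for
    \<open>s = ln m / 16\<close>, which makes \<open>miss\<close> polynomially small.\<close>
  define K where "K = 32 * (c + 3)"
  have "exp 1 \<le> K" using exp_le assms by (simp add: K_def)
  then have K: "1 \<le> K" "1 \<le> ln K"
    using assms by (auto simp: K_def ln_ge_iff)
  have K1: "1 < K" using assms by (simp add: K_def)
  \<comment> \<open>Asymptotic inequalities in \<open>x = m\<close> behind the numerical hypotheses
    of \<open>worst_depth_ge\<close> and the rounding of \<open>L\<close> and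
    \<open>n\<close>.\<close>
  let ?ok = "\<lambda>x::real. ln x * x powr (- 1/8) \<le> 1/2 \<and>
    exp (- ((x powr (1/4) - 1) * x powr (- 1/8))) \<le> x powr (- (c + 2)) \<and>
    x powr (1/4) * ln x * x powr (- (c + 3)) \<le> x powr (- (c + 2)) \<and>
    (x powr c * ln x + 1) * x powr (- (c + 2)) \<le> 1/4 \<and>
    x powr (1/4) * ln x * exp (- (x powr (- 1/2) * x / 2)) \<le> 1/4 \<and>
    ln x / (16 * ln K) \<le> ln x / (8 * ln K) - 1 \<and> 8 \<le> ln x \<and> 2 \<le> x powr (1/4) \<and> 1 \<le> x"
  have "\<forall>\<^sub>F x in at_top. ?ok x"
    using assms K(2) by (intro eventually_conj; real_asymp)
  then have "\<forall>\<^sub>F m in sequentially. ?ok (real m)"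
    by (rule eventually_compose_filterlim) (rule filterlim_real_sequentially)
  then obtain m0 where m0: "\<And>m. m \<ge> m0 \<Longrightarrow> ?ok (real m)"
    unfolding eventually_sequentially by blast
  \<comment> \<open>32 combines the 16 in \<open>L \<ge> ln m / (16 * ln K)\<close>, which absorbs
    rounding, with the factor 1/2 of \<open>worst_depth_ge\<close>.\<close>
  have "ereal (1 / (32 * ln K) * ln (real m)) \<le> T_ind_prob m q"
    if "m \<ge> m0" and q: "real q \<le> real m powr c" for m q
    unfolding T_ind_prob_def
  proof (rule INF_greatest, clarsimp)
    fix H assume H: "decision_tree m q H" "solves_spanning_forest m H"
    define x where "x = real m"
    have "?ok x" unfolding x_def using \<open>m \<ge> m0\<close> by (rule m0)
    then have ok: "ln x * x powr (- 1/8) \<le> 1/2"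
      "exp (- ((x powr (1/4) - 1) * x powr (- 1/8))) \<le> x powr (- (c + 2))"
      "x powr (1/4) * ln x * x powr (- (c + 3)) \<le> x powr (- (c + 2))"
      "(x powr c * ln x + 1) * x powr (- (c + 2)) \<le> 1/4"
      "x powr (1/4) * ln x * exp (- (x powr (- 1/2) * x / 2)) \<le> 1/4"
      "ln x / (16 * ln K) \<le> ln x / (8 * ln K) - 1" "8 \<le> ln x" "2 \<le> x powr (1/4)" "1 \<le> x"
      by blast+
    have x: "0 < x" using ok(9) by linarith
    \<comment> \<open>This makes \<open>K ^ L\<close> at most \<open>x powr (1/8)\<close>, so the
      densities stay between \<open>x powr (- 1/2)\<close> and \<open>x powr (- 3/8)\<close> and,
      times about \<open>x powr (1/4) * ln x\<close> rows, still tend to 0.\<close>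
    define L where "L = nat \<lfloor>ln x / (8 * ln K)\<rfloor>"
    define n where "n = nat \<lfloor>x powr (1/4)\<rfloor>"
    have nn: "0 \<le> ln x / (8 * ln K)" using ok(7) K by (intro divide_nonneg_nonneg) linarith+
    have L: "real L \<le> ln x / (8 * ln K)" "ln x / (8 * ln K) - 1 \<le> real L"
      unfolding L_def using nn by linarith+
    have n: "real n \<le> x powr (1/4)" "x powr (1/4) - 1 \<le> real n"
      unfolding n_def using ok(8) by linarith+
    have "ln x / (8 * ln K) \<le> ln x / 1"
      using ok(7) K(2) by (intro divide_left_mono) (linarith | simp)+
    then have L_le: "real L \<le> ln x" using L(1) by simp
    have L_ge: "ln x / (16 * ln K) \<le> real L" using ok(6) L(2) by linarith
    moreover have "0 < ln x / (16 * ln K)" using ok(7) K by (intro divide_pos_pos) linarith+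
    ultimately have "0 < L" by linarith
    have "0 < n" using n(2) ok(8) by linarith
    have N_le: "real (L * n) \<le> x powr (1/4) * ln x"
      using mult_mono[OF L_le n(1)] ok(7) by (simp add: mult.commute)
    have "K ^ (L - 1) \<le> K powr real L"
      using K power_increasing[of "L - 1" L K] by (simp add: powr_realpow)
    also have "\<dots> \<le> exp (ln x / 8)"
    proof -
      have "real L * ln K \<le> ln x / (8 * ln K) * ln K"
        using L(1) K(2) by (intro mult_right_mono) linarith+
      also have "\<dots> = ln x / 8" using K1 by simp
      finally have "exp (real L * ln K) \<le> exp (ln x / 8)" by simp
      moreover have "K powr real L = exp (real L * ln K)" using K1 by (simp add: powr_def)
      ultimately show ?thesis by simp
    qed
    also have "\<dots> = x powr (1/8)" using x by (simp add: powr_def)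
    finally have K_le: "K ^ (L - 1) \<le> x powr (1/8)" .
    have "real L / 2 \<le> worst_depth H m"
    proof (rule worst_depth_ge[OF H \<open>0 < n\<close> \<open>0 < L\<close> K(1) _ refl,
          where r = "x powr (- 1/2)" and s = "ln x / 16" and \<delta> = "x powr (- (c + 2))"])
      show "0 < x powr (- 1/2)" using x by simp
      have "real (L * n) * (x powr (- 1/2) * K ^ (L - 1)) \<le>
          (x powr (1/4) * ln x) * (x powr (- 1/2) * x powr (1/8))"
        using N_le K_le K ok(7) by (intro mult_mono) auto
      also have "\<dots> = ln x * (x powr (1/4) * x powr (- 1/2) * x powr (1/8))" by simp
      also have "\<dots> = ln x * x powr (- 1/8)" by (simp add: powr_add[symmetric])
      finally show "real (L * n) * (x powr (- 1/2) * K ^ (L - 1)) \<le> 1/2" using ok(1) by linarith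
      show "1/2 \<le> ln x / 16" using ok(7) by simp
      \<comment> \<open>A row of level \<open>k\<close> misses a small \<open>T\<close> with
        probability at least this; among about \<open>x powr (1/4)\<close> rows, all meet
        \<open>T\<close> with probability about \<open>exp (- (x powr (1/8)))\<close> at
        most.\<close>
      have y: "exp (- (2 * (ln x / 16))) = x powr (- 1/8)" using x by (simp add: powr_def)
      have "x powr (- 1/8) \<le> 1" using ok(9) powr_mono[of "- 1/8" 0 x] by simp
      then have "(1 - x powr (- 1/8)) ^ n \<le> exp (- (x powr (- 1/8))) ^ n"
        using exp_ge_add_one_self[of "- (x powr (- 1/8))"] by (intro power_mono) auto
      also have "\<dots> = exp (- (real n * x powr (- 1/8)))"
        by (simp add: exp_of_nat_mult[symmetric])
      also have "\<dots> \<le> exp (- ((x powr (1/4) - 1) * x powr (- 1/8)))"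
        using mult_right_mono[OF n(2), of "x powr (- 1/8)"] by simp
      finally show "(1 - exp (- (2 * (ln x / 16)))) ^ n \<le> x powr (- (c + 2))"
        unfolding y using ok(2) by linarith
      have "K * (ln x / 16) / 2 = (c + 3) * ln x" by (simp add: K_def)
      then have "exp (- (K * (ln x / 16) / 2)) = exp (- ((c + 3) * ln x))" by (rule arg_cong)
      also have "\<dots> = x powr (- (c + 3))" using x by (simp add: powr_def algebra_simps)
      finally have "exp (- (K * (ln x / 16) / 2)) = x powr (- (c + 3))" .
      then show "real (L * n) * exp (- (K * (ln x / 16) / 2)) \<le> x powr (- (c + 2))"
        using mult_right_mono[OF N_le, of "x powr (- (c + 3))"] ok(3) by simp
      have "(real q * real L + 1) * x powr (- (c + 2)) \<le> (x powr c * ln x + 1) * x powr (- (c + 2))"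
        using q L_le by (intro mult_right_mono add_right_mono mult_mono) (auto simp: x_def)
      then show "(real q * real L + 1) * x powr (- (c + 2)) \<le> 1/4" using ok(4) by linarith
      have "real (L * n) * exp (- (x powr (- 1/2) * x / 2)) \<le> 1/4"
        using mult_right_mono[OF N_le exp_ge_zero] ok(5) by (rule order_trans)
      then show "real (L * n) * exp (- (x powr (- 1/2) * real m / 2)) \<le> 1/4"
        by (simp only: x_def)
    qed
    then show "ln (real m) / (32 * ln K) \<le> worst_depth H m"
      using L_ge by (simp add: x_def)
  qed
  moreover have "0 < 1 / (32 * ln K)" using K by (intro divide_pos_pos) linarith+
  ultimately show ?thesis by blast
qed

end
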